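(* Let $\epsilon\in(0,1/5)$ and suppose $T \ge 2k^{2.3}$. Then there exists a (randomized, distributed) algorithm for the distributed non-stochastic experts problem in the site prediction model with $k$ sites, $n$ experts and time horizon $T$ that, against any oblivious adversary, achieves expected regret $$O\!\left(\log(n)\,\sqrt{k^{5(1+\epsilon)/6}\,T}\right)$$ and uses expected communication $$O\!\left(T/k^{\epsilon}\right).$$
   Context: Site prediction model. A distributed system consists of one coordinator node connected to $k$ site nodes; sites communicate with each other only via the coordinator. There are $n$ experts $[n]=\{1,\dots,n\}$ and a known time horizon $T$. At each time step $t=1,\dots,T$ one site $s^t$ receives a query and must pick an expert $a^t\in[n]$; then a payoff vector $\mathbf p^t\in[0,1]^n$ is revealed only to the site $s^t$, and the system receives payoff $\mathbf p^t[a^t]$. The algorithm may use randomness both to pick experts and to decide when to communicate. The adversary chooses the payoff vectors $\mathbf p^1,\dots,\mathbf p^T$ and the sites $s^1,\dots,s^T$. An oblivious adversary knows the description of the algorithm but cannot see any of its actions, communication or random bits; equivalently, the sequences $(\mathbf p^t)$ and $(s^t)$ are fixed in advance. Expected regret is $\mathbb E\big[\max_{a\in[n]}\sum_{t=1}^T\mathbf p^t[a]-\sum_{t=1}^T\mathbf p^t[a^t]\big]$, the expectation being over the algorithm's random choices. Expected communication is the expected number of messages sent between nodes. Message sizes may depend on $n$ but not on $k$ or $T$ (each message contains at most $n$ real numbers). Communication has zero delay: messages are received before any later query arrives. It is assumed that $n$ is substantially smaller than $T$ and $k$. The $O(\cdot)$ constants are absolute, the asymptotics being in terms of $k$ and $T$.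 (The trivial benchmarks are regret of order $\sqrt{kT}$ with communication $0$, and communication of order $T$; the range $\epsilon\in(0,1/5)$ is the one in which the guarantee is non-trivial, since then $5(1+\epsilon)/6<1$ and $\epsilon>0$.) *)

theory Defs
  imports "HOL-Probability.Probability"
begin

text \<open>
  The site prediction model for the distributed experts problem: one coordinator and sites
  \<open>0, \<dots>, k - 1\<close>, experts \<open>0, \<dots>, n - 1\<close>, time steps \<open>0, \<dots>, T - 1\<close>.
  A payoff vector is a list of length \<open>n\<close>. Sites exchange messages with the coordinator only.
\<close>

datatype node = Coordinator | Site nat

type_synonym payoff_vector = "real list"
type_synonym message = "real list"

text \<open>
  The private random tape of a node. Its law is chosen by the algorithm, and the tapes of
  different nodes are independent.
\<close>

type_synonym tape = "nat \<Rightarrow> real"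

text \<open>
  Everything a site ever observes. \<open>Query b\<close> opens a time step, where \<open>b\<close> says whether this site
  is the one queried; \<open>Inbox\<close> is the outcome of one communication round; \<open>Payoff\<close> carries the
  payoff vector to the queried site and \<open>None\<close> to all the others. The coordinator observes only
  its inbox, in each round one optional message per site. The system is synchronous: every node
  records an entry in each round, so a view also determines the current time step and round.
\<close>

datatype site_event = Query bool | Inbox "message option" | Payoff "payoff_vector option"

type_synonym site_view = "site_event list"
type_synonym coord_view = "(nat \<Rightarrow> message option) list"

text \<open>
  A node acts on its own tape and its own view only. Each time step has two communication phases,
  one between the query and the choice of the expert and one after the payoffs are revealed;
  each of them consists of \<open>rounds\<close> synchronous rounds, in which any node may stay silent.
\<close>

record algorithm =
  tape_law :: "node \<Rightarrow> tape measure"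
  rounds :: nat
  site_send :: "nat \<Rightarrow> tape \<Rightarrow> site_view \<Rightarrow> message option"
  coord_send :: "tape \<Rightarrow> coord_view \<Rightarrow> nat \<Rightarrow> message option"
  pick :: "nat \<Rightarrow> tape \<Rightarrow> site_view \<Rightarrow> nat"

record config =
  site_views :: "nat \<Rightarrow> site_view"
  coord_history :: coord_view
  message_count :: nat

definition initial_config :: config where
  "initial_config = \<lparr>site_views = (\<lambda>i. []), coord_history = [], message_count = 0\<rparr>"

definition comm_round :: "algorithm \<Rightarrow> nat \<Rightarrow> (node \<Rightarrow> tape) \<Rightarrow> config \<Rightarrow> config" where
  "comm_round A k \<omega> c =
    (let up = (\<lambda>i. if i < k then site_send A i (\<omega> (Site i)) (site_views c i) else None);
         down = (\<lambda>i. if i < k then coord_send A (\<omega> Coordinator) (coord_history c) i else None)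
     in \<lparr>site_views = (\<lambda>i. site_views c i @ [Inbox (down i)]),
         coord_history = coord_history c @ [up],
         message_count =
           message_count c + card {i. i < k \<and> up i \<noteq> None} + card {i. i < k \<and> down i \<noteq> None}\<rparr>)"

definition comm_phase :: "algorithm \<Rightarrow> nat \<Rightarrow> (node \<Rightarrow> tape) \<Rightarrow> config \<Rightarrow> config" where
  "comm_phase A k \<omega> = comm_round A k \<omega> ^^ rounds A"

definition query_phase :: "algorithm \<Rightarrow> nat \<Rightarrow> (node \<Rightarrow> tape) \<Rightarrow> nat \<Rightarrow> config \<Rightarrow> config" where
  "query_phase A k \<omega> j c =
    comm_phase A k \<omega> (c\<lparr>site_views := (\<lambda>i. site_views c i @ [Query (i = j)])\<rparr>)"

definition payoff_phase ::
    "algorithm \<Rightarrow> nat \<Rightarrow> (node \<Rightarrow> tape) \<Rightarrow> nat \<Rightarrow> payoff_vector \<Rightarrow> config \<Rightarrow> config" where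
  "payoff_phase A k \<omega> j v c =
    comm_phase A k \<omega>
      (c\<lparr>site_views := (\<lambda>i. site_views c i @ [Payoff (if i = j then Some v else None)])\<rparr>)"

text \<open>\<open>run A k \<omega> s p t\<close> is the configuration after the first \<open>t\<close> time steps.\<close>

primrec run ::
    "algorithm \<Rightarrow> nat \<Rightarrow> (node \<Rightarrow> tape) \<Rightarrow> (nat \<Rightarrow> nat) \<Rightarrow> (nat \<Rightarrow> payoff_vector) \<Rightarrow> nat \<Rightarrow> config" where
  "run A k \<omega> s p 0 = initial_config"
| "run A k \<omega> s p (Suc t) =
     payoff_phase A k \<omega> (s t) (p t) (query_phase A k \<omega> (s t) (run A k \<omega> s p t))"

definition chosen_expert ::
    "algorithm \<Rightarrow> nat \<Rightarrow> (node \<Rightarrow> tape) \<Rightarrow> (nat \<Rightarrow> nat) \<Rightarrow> (nat \<Rightarrow> payoff_vector) \<Rightarrow> nat \<Rightarrow> nat" where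
  "chosen_expert A k \<omega> s p t =
    pick A (s t) (\<omega> (Site (s t))) (site_views (query_phase A k \<omega> (s t) (run A k \<omega> s p t)) (s t))"

definition nodes :: "nat \<Rightarrow> node set" where
  "nodes k = insert Coordinator (Site ` {..<k})"

definition randomness :: "nat \<Rightarrow> algorithm \<Rightarrow> (node \<Rightarrow> tape) measure" where
  "randomness k A = PiM (nodes k) (tape_law A)"

text \<open>An oblivious adversary fixes the queried sites \<open>s\<close> and the payoff vectors \<open>p\<close> in advance.\<close>

definition oblivious_adversary ::
    "nat \<Rightarrow> nat \<Rightarrow> nat \<Rightarrow> (nat \<Rightarrow> nat) \<Rightarrow> (nat \<Rightarrow> payoff_vector) \<Rightarrow> bool" where
  "oblivious_adversary n k T s p \<longleftrightarrow>
    (\<forall>t<T. s t < k \<and> length (p t) = n \<and> (\<forall>a<n. 0 \<le> p t ! a \<and> p t ! a \<le> 1))"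

text \<open>
  The two measurability clauses make the regret and the number of messages random variables; both
  are bounded, hence integrable.
\<close>

definition valid_algorithm :: "nat \<Rightarrow> nat \<Rightarrow> nat \<Rightarrow> algorithm \<Rightarrow> bool" where
  "valid_algorithm n k T A \<longleftrightarrow>
    (\<forall>v \<in> nodes k. prob_space (tape_law A v)) \<and>
    (\<forall>i<k. \<forall>r view. pick A i r view < n) \<and>
    (\<forall>i<k. \<forall>r view m. site_send A i r view = Some m \<longrightarrow> length m \<le> n) \<and>
    (\<forall>i<k. \<forall>r view m. coord_send A r view i = Some m \<longrightarrow> length m \<le> n) \<and>
    (\<forall>s p. oblivious_adversary n k T s p \<longrightarrow>
      (\<forall>t<T. (\<lambda>\<omega>. chosen_expert A k \<omega> s p t) \<in> randomness k A \<rightarrow>\<^sub>M count_space UNIV) \<and>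
      (\<lambda>\<omega>. message_count (run A k \<omega> s p T)) \<in> randomness k A \<rightarrow>\<^sub>M count_space UNIV)"

definition regret ::
    "nat \<Rightarrow> nat \<Rightarrow> nat \<Rightarrow> algorithm \<Rightarrow> (nat \<Rightarrow> nat) \<Rightarrow> (nat \<Rightarrow> payoff_vector) \<Rightarrow> (node \<Rightarrow> tape) \<Rightarrow> real" where
  "regret n k T A s p \<omega> =
    Max ((\<lambda>a. \<Sum>t<T. p t ! a) ` {..<n}) - (\<Sum>t<T. p t ! chosen_expert A k \<omega> s p t)"

definition expected_regret ::
    "nat \<Rightarrow> nat \<Rightarrow> nat \<Rightarrow> algorithm \<Rightarrow> (nat \<Rightarrow> nat) \<Rightarrow> (nat \<Rightarrow> payoff_vector) \<Rightarrow> real" where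
  "expected_regret n k T A s p = (\<integral>\<omega>. regret n k T A s p \<omega> \<partial>randomness k A)"

definition expected_communication ::
    "nat \<Rightarrow> nat \<Rightarrow> algorithm \<Rightarrow> (nat \<Rightarrow> nat) \<Rightarrow> (nat \<Rightarrow> payoff_vector) \<Rightarrow> real" where
  "expected_communication k T A s p =
    (\<integral>\<omega>. real (message_count (run A k \<omega> s p T)) \<partial>randomness k A)"

end

theory Submission imports Defs begin

text \<open>
  Every queried site reports its payoff vector to the coordinator with probability
  \<open>q = k powr - \<epsilon>\<close>. The coordinator follows the perturbed leader of the reported payoffs, with a
  single initial perturbation by independent geometric variables of parameter \<open>\<pi>\<close>, and broadcasts
  the leader only when it changes. A report changes the leader with probability at most \<open>\<pi>\<close>, so the
  expected number of messages is at most \<open>q T + k (1 + q \<pi> T)\<close>. Against the reported payoffs the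
  regret is at most the number of changes plus the largest perturbation, which has mean at most
  \<open>(ln n + 2) / \<pi>\<close>; dividing by \<open>q\<close> gives the regret bound \<open>\<pi> T + (ln n + 2) / (\<pi> q)\<close>.
  The choice \<open>\<pi> = k powr \<epsilon> / R\<close>, where \<open>R\<close> is the square root in the regret bound, makes all
  these terms small enough, since \<open>7 (1 + \<epsilon>) / 6 < 23/10\<close>.
\<close>

subsection \<open>Perturbed leaders\<close>

text \<open>Ties go to the smallest index. This convention is the source of the strict inequalities
  at smaller indices in \<open>leader_before\<close> and \<open>leader_eqI\<close>.\<close>

definition leader :: "nat \<Rightarrow> (nat \<Rightarrow> real) \<Rightarrow> nat" where
  "leader n x = (LEAST a. a < n \<and> (\<forall>b<n. x b \<le> x a))"

lemma leader:
  assumes "n \<ge> 1"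
  shows leader_less: "leader n x < n"
    and leader_maximal: "b < n \<Longrightarrow> x b \<le> x (leader n x)"
proof -
  have "Max (x ` {..<n}) \<in> x ` {..<n}"
    using assms by (intro Max_in) (auto simp: lessThan_empty_iff)
  then obtain a where a: "a < n" "x a = Max (x ` {..<n})" by auto
  have "a < n \<and> (\<forall>b<n. x b \<le> x a)"
    using a by (auto intro!: Max_ge)
  then have "leader n x < n \<and> (\<forall>b<n. x b \<le> x (leader n x))"
    unfolding leader_def by (rule LeastI)
  then show "leader n x < n" "b < n \<Longrightarrow> x b \<le> x (leader n x)" by auto
qed

lemma leader_before: "b < leader n x \<Longrightarrow> n \<ge> 1 \<Longrightarrow> x b < x (leader n x)"
  using not_less_Least[of b "\<lambda>a. a < n \<and> (\<forall>b<n. x b \<le> x a)"] leader_less[of n x] leader_maximal[of n _ x]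
  unfolding leader_def[symmetric] by (metis dual_order.trans linorder_not_le order_less_imp_le)

lemma leader_eqI:
  assumes "a < n" "\<And>b. b < n \<Longrightarrow> x b \<le> x a" "\<And>b. b < a \<Longrightarrow> x b < x a"
  shows "leader n x = a"
  unfolding leader_def using assms
  by (intro Least_equality) (auto simp: not_less[symmetric])

text \<open>In each update the new leader's old score is at most that of the old leader, and its
  last gain is the new summand. So playing the leader of the next time step loses at most an initial
  score.\<close>

lemma be_the_leader:
  fixes x\<^sub>0 :: "nat \<Rightarrow> real" and g :: "nat \<Rightarrow> nat \<Rightarrow> real"
  assumes "n \<ge> 1"
  defines "x \<equiv> \<lambda>t a. x\<^sub>0 a + (\<Sum>u<t. g u a)"
  shows "x T (leader n (x T))
    \<le> x\<^sub>0 (leader n x\<^sub>0) + (\<Sum>t<T. g t (leader n (x (Suc t))))"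
proof (induction T)
  case 0
  show ?case by (simp add: x_def)
next
  case (Suc T)
  have "x (Suc T) (leader n (x (Suc T)))
      = x T (leader n (x (Suc T))) + g T (leader n (x (Suc T)))"
    by (simp add: x_def)
  also have "x T (leader n (x (Suc T))) \<le> x T (leader n (x T))"
    using leader[OF assms(1)] by blast
  finally show ?case using Suc.IH by simp
qed

subsection \<open>Perturbation by geometric noise\<close>

text \<open>Geometric noise is the discrete analogue of exponential noise: it is memoryless, so
  every further unit costs the same factor of probability mass.\<close>

definition noise_pmf :: "nat \<Rightarrow> real \<Rightarrow> (nat \<Rightarrow> nat) pmf" where
  "noise_pmf n \<pi> = Pi_pmf {..<n} 0 (\<lambda>_. geometric_pmf \<pi>)"

lemma pmf_noise_bump:
  assumes "a < n" "0 < \<pi>" "\<pi> \<le> 1"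
  shows "pmf (noise_pmf n \<pi>) (z(a := Suc (z a))) = (1 - \<pi>) * pmf (noise_pmf n \<pi>) z"
proof (cases "\<forall>x. x \<notin> {..<n} \<longrightarrow> z x = 0")
  case True
  have "pmf (noise_pmf n \<pi>) (z(a := Suc (z a)))
      = (\<Prod>b<n. pmf (geometric_pmf \<pi>) ((z(a := Suc (z a))) b))"
    unfolding noise_pmf_def using True assms by (subst pmf_Pi') auto
  also have "\<dots> = (\<Prod>b<n. (if b = a then 1 - \<pi> else 1) * pmf (geometric_pmf \<pi>) (z b))"
    using assms by (intro prod.cong) auto
  also have "\<dots> = (1 - \<pi>) * (\<Prod>b<n. pmf (geometric_pmf \<pi>) (z b))"
    using assms by (simp add: prod.distrib prod.delta)
  also have "(\<Prod>b<n. pmf (geometric_pmf \<pi>) (z b)) = pmf (noise_pmf n \<pi>) z"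
    unfolding noise_pmf_def using True by (subst pmf_Pi') auto
  finally show ?thesis .
next
  case False
  then have "pmf (noise_pmf n \<pi>) z = 0"
    unfolding noise_pmf_def by (intro pmf_Pi_outside) auto
  moreover have "pmf (noise_pmf n \<pi>) (z(a := Suc (z a))) = 0"
    unfolding noise_pmf_def using False assms
    by (intro pmf_Pi_outside) (simp_all, metis less_irrefl not_less)
  ultimately show ?thesis by simp
qed

text \<open>
  Adding one unit of noise to the current leader is an injection that multiplies probabilities by
  \<open>1 - \<pi>\<close>, and every noise vector in its image gives the same leader before and after an update.
\<close>

lemma prob_leader_change:
  fixes G G' :: "nat \<Rightarrow> real"
  assumes n: "n \<ge> 1" and \<pi>: "0 < \<pi>" "\<pi> \<le> 1"
    and G: "\<And>a. a < n \<Longrightarrow> G a \<le> G' a" "\<And>a. a < n \<Longrightarrow> G' a \<le> G a + 1"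
  shows "measure_pmf.prob (noise_pmf n \<pi>)
      {z. leader n (\<lambda>a. real (z a) + G a) \<noteq> leader n (\<lambda>a. real (z a) + G' a)} \<le> \<pi>"
proof -
  let ?N = "noise_pmf n \<pi>"
  define L where "L z = leader n (\<lambda>a. real (z a) + G a)" for z :: "nat \<Rightarrow> nat"
  define L' where "L' z = leader n (\<lambda>a. real (z a) + G' a)" for z :: "nat \<Rightarrow> nat"
  define \<Phi> where "\<Phi> z = z(L z := Suc (z (L z)))" for z
  have Ln: "L z < n" for z unfolding L_def using n by (rule leader_less)
  have le: "real (z b) + G b \<le> real (z (L z)) + G (L z)" if "b < n" for z b
    using leader_maximal[OF n that, of "\<lambda>a. real (z a) + G a"] by (simp add: L_def)
  have lt: "real (z b) + G b < real (z (L z)) + G (L z)" if "b < L z" for z b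
    using leader_before[OF that[unfolded L_def] n] by (simp add: L_def)
  have L\<Phi>: "L (\<Phi> z) = L z" for z
    unfolding L_def[of "\<Phi> z"]
    by (rule leader_eqI)
      (use Ln[of z] le[of _ z] lt[of _ z] in \<open>auto simp: \<Phi>_def intro: less_imp_le add_strict_mono, fastforce+\<close>)
  \<comment> \<open>The extra unit outweighs any update, since \<open>G'\<close> exceeds
    \<open>G\<close> by at most 1. Strictness at smaller indices survives, so ties cannot move the
    leader.\<close>
  have L'\<Phi>: "L' (\<Phi> z) = L z" for z
    unfolding L'_def[of "\<Phi> z"]
  proof (rule leader_eqI)
    fix b assume b: "b < n"
    show "real (\<Phi> z b) + G' b \<le> real (\<Phi> z (L z)) + G' (L z)"
      using le[OF b, of z] G(2)[OF b] G(1)[OF Ln[of z]] by (auto simp: \<Phi>_def)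
  next
    fix b assume b: "b < L z"
    then have "b < n" using Ln[of z] by simp
    then show "real (\<Phi> z b) + G' b < real (\<Phi> z (L z)) + G' (L z)"
      using lt[OF b] G(2)[of b] G(1)[OF Ln[of z]] b by (auto simp: \<Phi>_def)
  qed (rule Ln)
  \<comment> \<open>The leader of \<open>\<Phi> z\<close> is still \<open>L z\<close>, so the bumped
    coordinate can be read off and the bump undone.\<close>
  have "inj \<Phi>"
  proof (rule injI)
    fix z w assume eq: "\<Phi> z = \<Phi> w"
    then have L: "L z = L w" using L\<Phi> by metis
    show "z = w"
    proof
      fix a
      show "z a = w a"
        using fun_cong[OF eq, of a] L by (auto simp: \<Phi>_def split: if_splits)
    qed
  qed
  have "1 - \<pi> = (1 - \<pi>) * infsetsum (pmf ?N) UNIV"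
    by (simp add: infsetsum_pmf_eq_1)
  also have "\<dots> = infsetsum (\<lambda>z. (1 - \<pi>) * pmf ?N z) UNIV"
    by (subst infsetsum_cmult_right) auto
  also have "\<dots> = infsetsum (\<lambda>z. pmf ?N (\<Phi> z)) UNIV"
    unfolding \<Phi>_def using pmf_noise_bump[OF Ln \<pi>] by simp
  also have "\<dots> = measure_pmf.prob ?N (range \<Phi>)"
    using \<open>inj \<Phi>\<close> by (simp add: measure_pmf_conv_infsetsum infsetsum_reindex)
  also have "\<dots> \<le> measure_pmf.prob ?N {z. L z = L' z}"
    using L\<Phi> L'\<Phi> by (intro measure_pmf.finite_measure_mono) auto
  also have "\<dots> = 1 - measure_pmf.prob ?N {z. L z \<noteq> L' z}"
    by (subst measure_pmf.prob_compl[symmetric]) (auto intro!: arg_cong[where f="measure _"])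
  finally show ?thesis by (simp add: L_def L'_def)
qed

text \<open>Condition on the first trial: a success gives 0 and no excess, a failure gives a fresh
  copy plus one. So each increase of the threshold multiplies the mean of the positive part by
  \<open>1 - \<pi>\<close>.\<close>

lemma geometric_excess:
  assumes \<pi>: "0 < \<pi>" "\<pi> \<le> 1"
  shows "integrable (measure_pmf (geometric_pmf \<pi>)) (\<lambda>z. real (z - m))"
    and "measure_pmf.expectation (geometric_pmf \<pi>) (\<lambda>z. real (z - m)) \<le> (1 - \<pi>) ^ m / \<pi>"
proof -
  let ?g = "geometric_pmf \<pi>"
  have real: "integrable (measure_pmf ?g) real"
    using \<pi> by (intro integrable_real_geometric_pmf) auto
  show int: "integrable (measure_pmf ?g) (\<lambda>z. real (z - m))" for m
    by (rule Bochner_Integration.integrable_bound[OF real]) auto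
  have "(\<integral>\<^sup>+z. real (z - m) \<partial>?g) \<le> ennreal ((1 - \<pi>) ^ m / \<pi>)"
  proof (induction m)
    case 0
    have "(\<integral>\<^sup>+z. real z \<partial>?g) = ennreal ((1 - \<pi>) / \<pi>)"
      using expectation_geometric_pmf[of \<pi>] \<pi> real
      by (subst nn_integral_eq_integral) auto
    then show ?case using \<pi> by (auto intro!: ennreal_leI divide_right_mono)
  next
    case (Suc m)
    have "(\<integral>\<^sup>+z. real (z - Suc m) \<partial>?g) = ennreal (1 - \<pi>) * (\<integral>\<^sup>+z. real (z - m) \<partial>?g)"
      using \<pi> by (subst geometric_bind_pmf_unfold) (auto simp: ennreal_minus[symmetric] mult.commute)
    also have "\<dots> \<le> ennreal (1 - \<pi>) * ennreal ((1 - \<pi>) ^ m / \<pi>)"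
      by (intro mult_left_mono Suc) auto
    also have "\<dots> = ennreal ((1 - \<pi>) ^ Suc m / \<pi>)"
      using \<pi> by (simp add: ennreal_mult[symmetric])
    finally show ?case .
  qed
  then show "measure_pmf.expectation ?g (\<lambda>z. real (z - m)) \<le> (1 - \<pi>) ^ m / \<pi>"
    using \<pi> int by (subst (asm) nn_integral_eq_integral) auto
qed

text \<open>The maximum is at most a threshold \<open>m\<close> plus the sum of all excesses over
  \<open>m\<close>. With \<open>m\<close> near \<open>ln n / \<pi>\<close> the \<open>n\<close>
  excesses have total mean at most \<open>1 / \<pi>\<close>.\<close>

lemma max_noise:
  assumes n: "n \<ge> 1" and \<pi>: "0 < \<pi>" "\<pi> \<le> 1"
  shows "integrable (measure_pmf (noise_pmf n \<pi>)) (\<lambda>z. real (Max (z ` {..<n})))"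
    and "measure_pmf.expectation (noise_pmf n \<pi>) (\<lambda>z. real (Max (z ` {..<n}))) \<le> (ln n + 2) / \<pi>"
proof -
  let ?N = "noise_pmf n \<pi>"
  define m where "m = nat \<lceil>ln n / \<pi>\<rceil>"
  have comp: "map_pmf (\<lambda>z. z a) ?N = geometric_pmf \<pi>" if "a < n" for a
    unfolding noise_pmf_def using that by (subst Pi_pmf_component) auto
  have int: "integrable (measure_pmf ?N) (\<lambda>z. real (z a - m))" if "a < n" for a m
    using geometric_excess(1)[OF \<pi>, of m] unfolding comp[OF that, symmetric]
    by (simp add: map_pmf_rep_eq integrable_distr_eq)
  have exp: "measure_pmf.expectation ?N (\<lambda>z. real (z a - m)) \<le> (1 - \<pi>) ^ m / \<pi>" if "a < n" for a
    using geometric_excess(2)[OF \<pi>, of m] unfolding comp[OF that, symmetric] by simp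
  have le: "real (Max (z ` {..<n})) \<le> real m + (\<Sum>a<n. real (z a - m))" for z m
  proof -
    have "Max (z ` {..<n}) \<in> z ` {..<n}"
      using n by (intro Max_in) (auto simp: lessThan_empty_iff)
    then obtain a where a: "a < n" "Max (z ` {..<n}) = z a" by auto
    have "real (z a) \<le> real m + real (z a - m)" by simp
    also have "real (z a - m) \<le> (\<Sum>a<n. real (z a - m))"
      using a by (intro member_le_sum) auto
    finally show ?thesis using a by simp
  qed
  show intM: "integrable (measure_pmf ?N) (\<lambda>z. real (Max (z ` {..<n})))"
    by (rule Bochner_Integration.integrable_bound[where f="\<lambda>z. \<Sum>a<n. real (z a - 0)"])
      (use int[of _ 0] le[of _ 0] in \<open>auto intro: order_trans[OF _ abs_ge_self]\<close>)
  have "(1 - \<pi>) ^ m \<le> exp (- \<pi>) ^ m"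
    using \<pi> exp_ge_add_one_self[of "-\<pi>"] by (intro power_mono) auto
  also have "\<dots> = exp (- (\<pi> * m))" by (simp add: exp_of_nat_mult[symmetric] mult.commute)
  also have "\<dots> \<le> exp (- ln n)"
  proof -
    have "ln n / \<pi> \<le> m" unfolding m_def by (simp add: real_nat_ceiling_ge)
    then show ?thesis using \<pi> by (simp add: field_simps)
  qed
  also have "\<dots> = 1 / n" using n by (simp add: exp_minus inverse_eq_divide)
  finally have pow: "real n * ((1 - \<pi>) ^ m / \<pi>) \<le> 1 / \<pi>" using \<pi> n by (simp add: field_simps)
  have "measure_pmf.expectation ?N (\<lambda>z. real (Max (z ` {..<n})))
      \<le> measure_pmf.expectation ?N (\<lambda>z. real m + (\<Sum>a<n. real (z a - m)))"
    by (intro integral_mono intM le Bochner_Integration.integrable_add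
        Bochner_Integration.integrable_sum int) auto
  also have "\<dots> = real m + (\<Sum>a<n. measure_pmf.expectation ?N (\<lambda>z. real (z a - m)))"
    using int by (subst Bochner_Integration.integral_add) auto
  also have "\<dots> \<le> real m + (\<Sum>a<n. (1 - \<pi>) ^ m / \<pi>)"
    by (intro add_left_mono sum_mono exp) auto
  also have "\<dots> \<le> real m + 1 / \<pi>" using pow by simp
  also have "real m \<le> ln n / \<pi> + 1"
    unfolding m_def using n \<pi> by (simp add: ln_ge_zero)
  \<comment> \<open>Rounding up in \<open>m\<close> costs 1, which is at most
    \<open>1 / \<pi>\<close>; this gives the constant 2.\<close>
  also have "ln n / \<pi> + 1 + 1 / \<pi> \<le> (ln n + 2) / \<pi>"
    using \<pi> by (simp add: field_simps)
  finally show "measure_pmf.expectation ?N (\<lambda>z. real (Max (z ` {..<n}))) \<le> (ln n + 2) / \<pi>"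
    by simp
qed

subsection \<open>The sampled process\<close>

text \<open>The scores are not rescaled by \<open>1 / q\<close>: a step then adds at most 1 to each
  of them, as \<open>prob_leader_change\<close> demands.\<close>

definition sampled_sum :: "(nat \<Rightarrow> bool) \<Rightarrow> (nat \<Rightarrow> payoff_vector) \<Rightarrow> nat \<Rightarrow> nat \<Rightarrow> real" where
  "sampled_sum c p t a = (\<Sum>u<t. if c u then p u ! a else 0)"

definition leader_at ::
    "nat \<Rightarrow> (nat \<Rightarrow> payoff_vector) \<Rightarrow> (nat \<Rightarrow> bool) \<times> (nat \<Rightarrow> nat) \<Rightarrow> nat \<Rightarrow> nat" where
  "leader_at n p x t = leader n (\<lambda>a. real (snd x a) + sampled_sum (fst x) p t a)"

lemma leader_at_less: "n \<ge> 1 \<Longrightarrow> leader_at n p x t < n"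
  unfolding leader_at_def by (rule leader_less)

definition coins_pmf :: "nat \<Rightarrow> real \<Rightarrow> (nat \<Rightarrow> bool) pmf" where
  "coins_pmf T q = Pi_pmf {..<T} False (\<lambda>_. bernoulli_pmf q)"

definition sample_pmf :: "nat \<Rightarrow> nat \<Rightarrow> real \<Rightarrow> real \<Rightarrow> ((nat \<Rightarrow> bool) \<times> (nat \<Rightarrow> nat)) pmf" where
  "sample_pmf n T q \<pi> = pair_pmf (coins_pmf T q) (noise_pmf n \<pi>)"

lemma integrable_bounded_pmf:
  fixes f :: "'a \<Rightarrow> real"
  assumes "\<And>x. \<bar>f x\<bar> \<le> B"
  shows "integrable (measure_pmf D) f"
  by (rule measure_pmf.integrable_const_bound[where B=B]) (use assms in auto)

text \<open>Coin \<open>t\<close> splits off the product law and is independent of all that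
  \<open>h\<close> reads. Both expectations are expressed through \<open>J\<close>, the average of
  \<open>h\<close> over the noise and the other coins.\<close>

lemma expectation_coin_mult:
  assumes t: "t < T" and q: "0 \<le> q" "q \<le> 1"
    and h: "\<And>x. 0 \<le> h x" "\<And>x. h x \<le> 1"
    and indep: "\<And>c b z. h (c(t := b), z) = h (c, z)"
  shows "measure_pmf.expectation (sample_pmf n T q \<pi>) (\<lambda>x. of_bool (fst x t) * h x)
       = q * measure_pmf.expectation (sample_pmf n T q \<pi>) h"
proof -
  let ?D = "sample_pmf n T q \<pi>" and ?C = "Pi_pmf ({..<T} - {t}) False (\<lambda>_. bernoulli_pmf q)"
  define J where "J = (\<integral>\<^sup>+c. \<integral>\<^sup>+z. ennreal (h (c, z)) \<partial>noise_pmf n \<pi> \<partial>?C)"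
  have coins: "coins_pmf T q = map_pmf (\<lambda>(b, f). f(t := b)) (pair_pmf (bernoulli_pmf q) ?C)"
    using Pi_pmf_insert[of "{..<T} - {t}" t False "\<lambda>_. bernoulli_pmf q"] t
    by (simp add: coins_pmf_def insert_absorb)
  have 1: "(\<integral>\<^sup>+x. ennreal (h x) \<partial>?D) = J"
    unfolding sample_pmf_def coins J_def using q
    by (simp add: nn_integral_pair_pmf' indep)
  have 2: "(\<integral>\<^sup>+x. ennreal (of_bool (fst x t) * h x) \<partial>?D) = ennreal q * J"
    unfolding sample_pmf_def coins J_def using q
    by (simp add: nn_integral_pair_pmf' indep mult.commute)
  have "integrable ?D h" "integrable ?D (\<lambda>x. of_bool (fst x t) * h x)"
    using h by (auto intro!: integrable_bounded_pmf[where B=1] simp: mult_le_one)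
  with 1 2 have "ennreal (measure_pmf.expectation ?D (\<lambda>x. of_bool (fst x t) * h x))
      = ennreal q * ennreal (measure_pmf.expectation ?D h)"
    using h by (subst (asm) (1 2) nn_integral_eq_integral) auto
  then show ?thesis
    using h q by (simp add: ennreal_mult[symmetric] integral_nonneg_AE)
qed

section \<open>Leader changes and regret of the sampled process\<close>

context
  fixes n T :: nat and q \<pi> :: real and p :: "nat \<Rightarrow> payoff_vector"
  assumes n: "n \<ge> 1" and q: "0 < q" "q \<le> 1" and \<pi>: "0 < \<pi>" "\<pi> \<le> 1"
    and p: "\<And>t a. t < T \<Longrightarrow> a < n \<Longrightarrow> 0 \<le> p t ! a \<and> p t ! a \<le> 1"
begin

private abbreviation E where "E \<equiv> measure_pmf.expectation (sample_pmf n T q \<pi>)"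

private abbreviation L where "L \<equiv> leader_at n p"

private abbreviation changes where
  "changes t x \<equiv> of_bool (L x t \<noteq> L x (Suc t)) :: real"

text \<open>Only coins before \<open>t\<close> enter the scores at time \<open>t\<close>; this is
  the independence that \<open>expectation_coin_mult\<close> asks for.\<close>

lemma leader_at_upd: "t \<le> u \<Longrightarrow> L (c(u := b), z) t = L (c, z) t"
  by (simp add: leader_at_def sampled_sum_def)

lemma payoff_bounds: "t < T \<Longrightarrow> 0 \<le> p t ! L x u" "t < T \<Longrightarrow> p t ! L x u \<le> 1"
  using p leader_at_less[OF n] by blast+

lemma expectation_coin: "t < T \<Longrightarrow> E (\<lambda>x. of_bool (fst x t)) = q"
  using expectation_coin_mult[of t T q "\<lambda>_. 1" n \<pi>] q by simp

lemma changes_imp_coin: "of_bool (fst x t) * changes t x = changes t x"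
  by (cases "fst x t") (auto simp: leader_at_def sampled_sum_def)

text \<open>The noise is independent of the coins. For fixed coins a change has probability at most
  \<open>\<pi>\<close> if coin \<open>t\<close> is set, and is impossible otherwise because the
  scores stay put.\<close>

lemma expectation_changes:
  assumes t: "t < T"
  shows "E (changes t) \<le> q * \<pi>"
proof -
  have *: "(\<integral>\<^sup>+z. ennreal (changes t (c, z)) \<partial>noise_pmf n \<pi>) \<le> ennreal \<pi> * of_bool (c t)" for c
  proof (cases "c t")
    case True
    have "(\<integral>\<^sup>+z. ennreal (changes t (c, z)) \<partial>noise_pmf n \<pi>)
        = (\<integral>\<^sup>+z. indicator {z. L (c, z) t \<noteq> L (c, z) (Suc t)} z \<partial>noise_pmf n \<pi>)"
      by (intro nn_integral_cong) (auto simp: indicator_def)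
    also have "\<dots> = ennreal (measure_pmf.prob (noise_pmf n \<pi>) {z. L (c, z) t \<noteq> L (c, z) (Suc t)})"
      by (simp add: measure_pmf.emeasure_eq_measure)
    also have "\<dots> \<le> ennreal \<pi>"
      unfolding leader_at_def fst_conv snd_conv
      by (intro ennreal_leI prob_leader_change) (use n \<pi> p t in \<open>auto simp: sampled_sum_def\<close>)
    finally show ?thesis using True by simp
  next
    case False
    then have "changes t (c, z) = 0" for z
      using changes_imp_coin[of "(c, z)" t] by simp
    then show ?thesis by simp
  qed
  have int: "integrable (sample_pmf n T q \<pi>) (changes t)"
       "integrable (sample_pmf n T q \<pi>) (\<lambda>x. of_bool (fst x t) :: real)"
    by (rule integrable_bounded_pmf[where B=1], simp)+
  have "ennreal (E (changes t)) = (\<integral>\<^sup>+x. ennreal (changes t x) \<partial>sample_pmf n T q \<pi>)"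
    using int by (subst nn_integral_eq_integral) auto
  also have "\<dots> \<le> (\<integral>\<^sup>+x. ennreal \<pi> * of_bool (fst x t) \<partial>sample_pmf n T q \<pi>)"
    unfolding sample_pmf_def nn_integral_pair_pmf'
    by (intro nn_integral_mono order_trans[OF *]) simp
  also have "\<dots> = ennreal \<pi> * (\<integral>\<^sup>+x. ennreal (of_bool (fst x t)) \<partial>sample_pmf n T q \<pi>)"
    by (subst nn_integral_cmult[symmetric]) (auto intro!: nn_integral_cong simp: of_bool_def)
  also have "\<dots> = ennreal (q * \<pi>)"
    using int expectation_coin[OF t] q \<pi>
    by (subst nn_integral_eq_integral) (auto simp: ennreal_mult[symmetric] mult.commute)
  finally show ?thesis using q \<pi> by (simp add: ennreal_le_iff)
qed

text \<open>
  The sampled payoffs are unbiased up to the factor \<open>q\<close>, and the leader at time \<open>t\<close> does not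
  depend on the coin at time \<open>t\<close>; so it suffices to bound the regret on the sampled payoffs.
\<close>

lemma expected_regret_bound:
  assumes a: "a < n"
  shows "(\<Sum>t<T. p t ! a) - E (\<lambda>x. \<Sum>t<T. p t ! L x t)
    \<le> \<pi> * real T + (ln (real n) + 2) / (\<pi> * q)"
proof -
  let ?M = "\<lambda>x :: (nat \<Rightarrow> bool) \<times> (nat \<Rightarrow> nat). real (Max (snd x ` {..<n}))"
  let ?c = "\<lambda>t x. of_bool (fst x t) :: real"
  have int: "integrable (sample_pmf n T q \<pi>) (\<lambda>x. ?c t x * p t ! a)"
    "integrable (sample_pmf n T q \<pi>) (\<lambda>x. ?c t x * p t ! L x t)"
    "integrable (sample_pmf n T q \<pi>) (changes t)"
    "integrable (sample_pmf n T q \<pi>) (\<lambda>x. p t ! L x t)" if "t < T" for t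
    using payoff_bounds[OF that] p[OF that a]
    by (auto intro!: integrable_bounded_pmf[where B=1] simp: mult_le_one)
  have "map_pmf snd (sample_pmf n T q \<pi>) = noise_pmf n \<pi>"
    by (simp add: sample_pmf_def map_snd_pair_pmf)
  then have intM: "integrable (sample_pmf n T q \<pi>) ?M" and M: "E ?M \<le> (ln (real n) + 2) / \<pi>"
    using max_noise[OF n \<pi>] integrable_map_pmf_eq[of snd "sample_pmf n T q \<pi>"
        "\<lambda>z. real (Max (z ` {..<n}))"]
      integral_map_pmf[of snd "sample_pmf n T q \<pi>" "\<lambda>z. real (Max (z ` {..<n}))"]
    by auto
  \<comment> \<open>This is the be-the-leader bound for fixed coins and noise, followed by a shift
    from the next leader to the current one.\<close>
  have pointwise: "(\<Sum>t<T. ?c t x * p t ! a)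
      \<le> ?M x + (\<Sum>t<T. ?c t x * p t ! L x t + changes t x)" for x
  proof -
    let ?G = "\<lambda>t a. real (snd x a) + (\<Sum>u<t. ?c u x * p u ! a)"
    have G: "leader n (?G t) = L x t" for t
      unfolding leader_at_def sampled_sum_def
      by (intro arg_cong[where f="leader n"] ext arg_cong2[where f="(+)"] sum.cong) auto
    have "(\<Sum>t<T. ?c t x * p t ! a) \<le> ?G T a" by simp
    also have "\<dots> \<le> ?G T (leader n (?G T))" by (rule leader_maximal[OF n a])
    also have "\<dots> \<le> snd x (leader n (\<lambda>a. real (snd x a)))
        + (\<Sum>t<T. ?c t x * p t ! leader n (?G (Suc t)))"
      by (rule be_the_leader[OF n])
    also have "\<dots> = snd x (leader n (\<lambda>a. real (snd x a)))
        + (\<Sum>t<T. ?c t x * p t ! L x (Suc t))"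
      unfolding G ..
    also have "snd x (leader n (\<lambda>a. real (snd x a))) \<le> Max (snd x ` {..<n})"
      using leader_less[OF n] by (intro Max_ge) auto
    \<comment> \<open>The payoffs of the two leaders can differ only at a change, and then by at
      most 1.\<close>
    also have "(\<Sum>t<T. ?c t x * p t ! L x (Suc t)) \<le> (\<Sum>t<T. ?c t x * p t ! L x t + changes t x)"
    proof (rule sum_mono)
      fix t assume "t \<in> {..<T}"
      then show "?c t x * p t ! L x (Suc t) \<le> ?c t x * p t ! L x t + changes t x"
        using payoff_bounds[of t x t] payoff_bounds[of t x "Suc t"] by (auto simp: of_bool_def)
    qed
    finally show ?thesis by simp
  qed
  have "q * (\<Sum>t<T. p t ! a) = (\<Sum>t<T. E (\<lambda>x. ?c t x * p t ! a))"
    using expectation_coin by (simp add: sum_distrib_left)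
  also have "\<dots> = E (\<lambda>x. \<Sum>t<T. ?c t x * p t ! a)"
    using int by (subst Bochner_Integration.integral_sum) auto
  also have "\<dots> \<le> E (\<lambda>x. ?M x + (\<Sum>t<T. ?c t x * p t ! L x t + changes t x))"
    using int intM pointwise
    by (intro integral_mono Bochner_Integration.integrable_add
        Bochner_Integration.integrable_sum) auto
  also have "\<dots> = E ?M + (\<Sum>t<T. E (\<lambda>x. ?c t x * p t ! L x t) + E (changes t))"
    using int intM
    by (subst Bochner_Integration.integral_add)
      (auto simp: Bochner_Integration.integral_sum Bochner_Integration.integral_add)
  also have "\<dots> \<le> (ln (real n) + 2) / \<pi> + (\<Sum>t<T. q * E (\<lambda>x. p t ! L x t) + q * \<pi>)"
  proof (intro add_mono M sum_mono)
    fix t assume "t \<in> {..<T}"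
    then have t: "t < T" by simp
    show "E (\<lambda>x. ?c t x * p t ! L x t) \<le> q * E (\<lambda>x. p t ! L x t)"
      using q payoff_bounds[OF t]
      by (intro eq_refl[OF expectation_coin_mult[where h="\<lambda>x. p t ! L x t"]] t)
        (auto simp: leader_at_upd)
    show "E (changes t) \<le> q * \<pi>" by (rule expectation_changes[OF t])
  qed
  also have "\<dots> = (ln (real n) + 2) / \<pi> + q * E (\<lambda>x. \<Sum>t<T. p t ! L x t) + q * (\<pi> * T)"
    using int by (simp add: Bochner_Integration.integral_sum sum.distrib sum_distrib_left)
  finally have "q * (\<Sum>t<T. p t ! a)
      \<le> (ln (real n) + 2) / \<pi> + q * E (\<lambda>x. \<Sum>t<T. p t ! L x t) + q * (\<pi> * T)" .
  moreover have scale: "q * ((ln (real n) + 2) / (\<pi> * q)) = (ln (real n) + 2) / \<pi>"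
    using q by simp
  ultimately have "q * ((\<Sum>t<T. p t ! a) - E (\<lambda>x. \<Sum>t<T. p t ! L x t))
      \<le> q * (\<pi> * real T + (ln (real n) + 2) / (\<pi> * q))"
    unfolding distrib_left right_diff_distrib scale by simp
  then show ?thesis using q by simp
qed

end

subsection \<open>The distributed algorithm\<close>

text \<open>Only the queried site reports, so in a run the sum has at most one nonzero term per
  round.\<close>

definition reported :: "nat \<Rightarrow> (nat \<Rightarrow> message option) \<Rightarrow> nat \<Rightarrow> real" where
  "reported k up a = (\<Sum>i<k. case up i of None \<Rightarrow> 0 | Some m \<Rightarrow> m ! a)"

text \<open>A node has no memory apart from its view, so the scores are recomputed from the whole
  history. The real tape encodes natural numbers, which the floor recovers.\<close>

definition coord_leader :: "nat \<Rightarrow> nat \<Rightarrow> tape \<Rightarrow> coord_view \<Rightarrow> nat" where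
  "coord_leader n k r h = leader n (\<lambda>a. real (nat \<lfloor>r a\<rfloor>) + (\<Sum>up\<leftarrow>h. reported k up a))"

text \<open>The default \<open>[]\<close> never decides a choice in a run, because the very first
  query round broadcasts to every site.\<close>

definition last_message :: "site_view \<Rightarrow> message" where
  "last_message v = fold (\<lambda>e m. case e of Inbox (Some m') \<Rightarrow> m' | _ \<Rightarrow> m) v []"

text \<open>
  A site appends four events to its view in every time step, so \<open>length v div 4\<close> is the current
  time step. In the round after a query the last reports in the coordinator's history are those of
  the previous time step, so comparing with \<open>butlast h\<close> detects a change of leader; in the round
  after the payoffs the last reports are empty and the coordinator stays silent.
\<close>

definition lazy_leader_algorithm :: "nat \<Rightarrow> nat \<Rightarrow> nat \<Rightarrow> real \<Rightarrow> real \<Rightarrow> algorithm" where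
  "lazy_leader_algorithm n k T q \<pi> =
    \<lparr>tape_law = (\<lambda>v. case v of
        Coordinator \<Rightarrow> measure_pmf (map_pmf (\<lambda>z a. real (z a)) (noise_pmf n \<pi>))
      | Site i \<Rightarrow> measure_pmf (map_pmf (\<lambda>c t. of_bool (c t)) (coins_pmf T q))),
     rounds = 1,
     site_send = (\<lambda>i r v. case last v of
        Payoff (Some x) \<Rightarrow> if r (length v div 4) > 0 then Some (take n x) else None
      | _ \<Rightarrow> None),
     coord_send = (\<lambda>r h i.
        if h = [] \<or> coord_leader n k r h \<noteq> coord_leader n k r (butlast h)
        then Some [real (coord_leader n k r h)] else None),
     pick = (\<lambda>i r v. min (nat \<lfloor>hd (last_message v)\<rfloor>) (n - 1))\<rparr>"

text \<open>For a fixed adversary the run depends on the tapes only through this: at each step only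
  the queried site's coin matters. Values out of range are fixed so that the result lies in the
  countable set \<open>samples\<close>.\<close>

definition observed ::
    "nat \<Rightarrow> nat \<Rightarrow> (nat \<Rightarrow> nat) \<Rightarrow> (node \<Rightarrow> tape) \<Rightarrow> (nat \<Rightarrow> bool) \<times> (nat \<Rightarrow> nat)" where
  "observed n T s \<omega> =
    (\<lambda>t. t < T \<and> \<omega> (Site (s t)) t > 0, \<lambda>a. if a < n then nat \<lfloor>\<omega> Coordinator a\<rfloor> else 0)"

lemma leader_cong: "(\<And>a. a < n \<Longrightarrow> x a = y a) \<Longrightarrow> leader n x = leader n y"
  unfolding leader_def by (metis (no_types, lifting))

lemma comm_round_eq:
  assumes "\<And>i. i < k \<Longrightarrow> site_send A i (\<omega> (Site i)) (site_views c i) = up i"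
    and "\<And>i. i < k \<Longrightarrow> coord_send A (\<omega> Coordinator) (coord_history c) i = down i"
    and "\<And>i. \<not> i < k \<Longrightarrow> up i = None" "\<And>i. \<not> i < k \<Longrightarrow> down i = None"
  shows "comm_round A k \<omega> c =
    \<lparr>site_views = (\<lambda>i. site_views c i @ [Inbox (down i)]),
     coord_history = coord_history c @ [up],
     message_count = message_count c + card {i. i < k \<and> up i \<noteq> None} + card {i. i < k \<and> down i \<noteq> None}\<rparr>"
proof -
  have "(\<lambda>i. if i < k then site_send A i (\<omega> (Site i)) (site_views c i) else None) = up"
    "(\<lambda>i. if i < k then coord_send A (\<omega> Coordinator) (coord_history c) i else None) = down"
    using assms by (auto simp: fun_eq_iff)
  then show ?thesis by (simp add: comm_round_def Let_def)
qed

section \<open>The run for fixed tapes, step by step\<close>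

context
  fixes n k T :: nat and q \<pi> :: real and s :: "nat \<Rightarrow> nat" and p :: "nat \<Rightarrow> payoff_vector"
    and \<omega> :: "node \<Rightarrow> tape"
  assumes n: "n \<ge> 1" and adv: "oblivious_adversary n k T s p"
begin

private abbreviation A where "A \<equiv> lazy_leader_algorithm n k T q \<pi>"
private abbreviation obs where "obs \<equiv> observed n T s \<omega>"

text \<open>Each step adds two rounds to the coordinator's history: the query round brings nothing,
  the payoff round at most the report of the queried site.\<close>

private definition reports :: "nat \<Rightarrow> coord_view" where
  "reports t = concat (map (\<lambda>u. [\<lambda>i. None, \<lambda>i. if i = s u \<and> fst obs u then Some (p u) else None]) [0..<t])"

text \<open>A change caused by the report of step \<open>t - 1\<close> is announced in the query
  round of step \<open>t\<close>. Step 0 always has a broadcast, which tells the sites the initial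
  leader.\<close>

private definition down_count :: "nat \<Rightarrow> nat" where
  "down_count t = (if t = 0 \<or> leader_at n p obs t \<noteq> leader_at n p obs (t - 1) then k else 0)"

lemma reports_Suc:
  "reports (Suc t) = reports t @ [\<lambda>i. None, \<lambda>i. if i = s t \<and> fst obs t then Some (p t) else None]"
  by (simp add: reports_def)

lemma reported_none [simp]: "reported k (\<lambda>i. None) a = 0"
  by (simp add: reported_def)

lemma sum_reported: "t \<le> T \<Longrightarrow> (\<Sum>up\<leftarrow>reports t. reported k up a) = sampled_sum (fst obs) p t a"
proof (induction t)
  case 0
  show ?case by (simp add: reports_def sampled_sum_def)
next
  case (Suc t)
  have "s t < k" using adv Suc.prems by (simp add: oblivious_adversary_def)
  have "reported k (\<lambda>i. if i = s t \<and> fst obs t then Some (p t) else None) a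
      = (\<Sum>i<k. if i = s t then (if fst obs t then p t ! a else 0) else 0)"
    unfolding reported_def by (intro sum.cong) auto
  also have "\<dots> = (if fst obs t then p t ! a else 0)" using \<open>s t < k\<close> by simp
  finally show ?case using Suc by (simp add: reports_Suc sampled_sum_def)
qed

lemma coord_leader_reports:
  "t \<le> T \<Longrightarrow> coord_leader n k (\<omega> Coordinator) (reports t) = leader_at n p obs t"
  "t \<le> T \<Longrightarrow> coord_leader n k (\<omega> Coordinator) (reports t @ [\<lambda>i. None]) = leader_at n p obs t"
  unfolding coord_leader_def leader_at_def
  by (rule leader_cong; simp add: sum_reported observed_def)+

lemma coord_send_query:
  assumes "t \<le> T"
  shows "coord_send A (\<omega> Coordinator) (reports t) i =
    (if t = 0 \<or> leader_at n p obs t \<noteq> leader_at n p obs (t - 1)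
     then Some [real (leader_at n p obs t)] else None)"
proof (cases t)
  case 0
  then show ?thesis
    using coord_leader_reports[of 0] by (simp add: lazy_leader_algorithm_def reports_def)
next
  case (Suc u)
  have "butlast (reports t) = reports u @ [\<lambda>i. None]"
    by (simp add: Suc reports_Suc butlast_append)
  moreover have "reports t \<noteq> []" by (simp add: Suc reports_Suc)
  ultimately show ?thesis
    using coord_leader_reports(1)[OF assms] coord_leader_reports(2)[of u] assms Suc
    by (simp add: lazy_leader_algorithm_def)
qed

lemma coord_send_payoff:
  "t \<le> T \<Longrightarrow> coord_send A (\<omega> Coordinator) (reports t @ [\<lambda>i. None]) i = None"
  by (simp add: lazy_leader_algorithm_def coord_leader_reports)

lemma site_send_query: "site_send A i r (v @ [Query b]) = None"
  by (simp add: lazy_leader_algorithm_def)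

text \<open>The new event makes the length \<open>4 * t + 3\<close>, so division by 4 still yields
  \<open>t\<close>.\<close>

lemma site_send_payoff:
  assumes "length v = 4 * t + 2"
  shows "site_send A i r (v @ [Payoff y]) =
    (case y of None \<Rightarrow> None | Some m \<Rightarrow> if r t > 0 then Some (take n m) else None)"
  using assms by (auto simp: lazy_leader_algorithm_def split: option.split)

text \<open>This is the invariant at the start of step \<open>t\<close>. The sites still hold the
  leader at \<open>t - 1\<close>, since the one at \<open>t\<close> is announced only after the
  query.\<close>

private definition state_ok :: "nat \<Rightarrow> config \<Rightarrow> bool" where
  "state_ok t c \<longleftrightarrow> coord_history c = reports t \<and>
     message_count c = (\<Sum>u<t. of_bool (fst obs u) + down_count u) \<and>
     (\<forall>i<k. length (site_views c i) = 4 * t \<and>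
       (t > 0 \<longrightarrow> last_message (site_views c i) = [real (leader_at n p obs (t - 1))]))"

lemma query_phase_state:
  assumes t: "t < T" and ok: "state_ok t c"
  shows "coord_history (query_phase A k \<omega> (s t) c) = reports t @ [\<lambda>i. None]"
    and "message_count (query_phase A k \<omega> (s t) c) = message_count c + down_count t"
    and "i < k \<Longrightarrow> length (site_views (query_phase A k \<omega> (s t) c) i) = 4 * t + 2"
    and "i < k \<Longrightarrow> last_message (site_views (query_phase A k \<omega> (s t) c) i)
      = [real (leader_at n p obs t)]"
proof -
  have rounds: "rounds A = 1" by (simp add: lazy_leader_algorithm_def)
  let ?e = "c\<lparr>site_views := \<lambda>i. site_views c i @ [Query (i = s t)]\<rparr>"
  let ?change = "t = 0 \<or> leader_at n p obs t \<noteq> leader_at n p obs (t - 1)"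
  let ?down = "\<lambda>i. if i < k \<and> ?change then Some [real (leader_at n p obs t)] else None"
  have "comm_round A k \<omega> ?e =
    \<lparr>site_views = (\<lambda>i. site_views ?e i @ [Inbox (?down i)]),
     coord_history = coord_history ?e @ [\<lambda>i. None],
     message_count = message_count ?e + card {i. i < k \<and> (None :: message option) \<noteq> None}
       + card {i. i < k \<and> ?down i \<noteq> None}\<rparr>"
  proof (rule comm_round_eq[where up = "\<lambda>i. None" and down = ?down])
    show "coord_send A (\<omega> Coordinator) (coord_history ?e) i = ?down i" if "i < k" for i
      using t that ok by (simp add: state_ok_def coord_send_query)
  qed (auto simp: site_send_query)
  moreover have "card {i. i < k \<and> ?down i \<noteq> None} = down_count t"
  proof -
    have "{i. i < k \<and> ?down i \<noteq> None} = (if ?change then {..<k} else {})" by auto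
    then show ?thesis by (simp add: down_count_def)
  qed
  ultimately have eq: "query_phase A k \<omega> (s t) c =
    \<lparr>site_views = (\<lambda>i. site_views ?e i @ [Inbox (?down i)]),
     coord_history = coord_history c @ [\<lambda>i. None],
     message_count = message_count c + down_count t\<rparr>"
    by (simp add: query_phase_def comm_phase_def rounds)
  show "coord_history (query_phase A k \<omega> (s t) c) = reports t @ [\<lambda>i. None]"
    using ok by (simp add: eq state_ok_def)
  show "message_count (query_phase A k \<omega> (s t) c) = message_count c + down_count t"
    by (simp add: eq)
  show "length (site_views (query_phase A k \<omega> (s t) c) i) = 4 * t + 2" if "i < k"
    using ok that by (simp add: eq state_ok_def)
  \<comment> \<open>Without a broadcast the stored message names the leader at \<open>t - 1\<close>,
    which is then also the leader at \<open>t\<close>.\<close>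
  show "last_message (site_views (query_phase A k \<omega> (s t) c) i) = [real (leader_at n p obs t)]"
    if "i < k"
    using ok that by (cases ?change) (auto simp: eq state_ok_def last_message_def)
qed

lemma payoff_phase_state:
  assumes t: "t < T" and ok: "state_ok t c"
  shows "state_ok (Suc t) (payoff_phase A k \<omega> (s t) (p t) (query_phase A k \<omega> (s t) c))"
proof -
  let ?d = "query_phase A k \<omega> (s t) c"
  note d = query_phase_state[OF t ok]
  have rounds: "rounds A = 1" by (simp add: lazy_leader_algorithm_def)
  have st: "s t < k" "length (p t) = n" using adv t by (auto simp: oblivious_adversary_def)
  have coin: "fst obs t \<longleftrightarrow> \<omega> (Site (s t)) t > 0" using t by (simp add: observed_def)
  let ?e = "?d\<lparr>site_views := \<lambda>i. site_views ?d i @ [Payoff (if i = s t then Some (p t) else None)]\<rparr>"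
  let ?up = "\<lambda>i. if i = s t \<and> fst obs t then Some (p t) else None"
  have "comm_round A k \<omega> ?e =
    \<lparr>site_views = (\<lambda>i. site_views ?e i @ [Inbox None]),
     coord_history = coord_history ?e @ [?up],
     message_count = message_count ?e + card {i. i < k \<and> ?up i \<noteq> None} + card {i. i < k \<and> (None :: message option) \<noteq> None}\<rparr>"
  proof (rule comm_round_eq[where up = ?up and down = "\<lambda>i. None"])
    show "site_send A i (\<omega> (Site i)) (site_views ?e i) = ?up i" if "i < k" for i
      using d(3)[OF that] st by (simp add: site_send_payoff coin)
    show "coord_send A (\<omega> Coordinator) (coord_history ?e) i = None" for i
      using t by (simp add: d(1) coord_send_payoff)
  qed (use st in auto)
  moreover have "card {i. i < k \<and> ?up i \<noteq> None} = of_bool (fst obs t)"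
  proof -
    have "{i. i < k \<and> ?up i \<noteq> None} = (if fst obs t then {s t} else {})" using st by auto
    then show ?thesis by simp
  qed
  ultimately have "payoff_phase A k \<omega> (s t) (p t) ?d =
    \<lparr>site_views = (\<lambda>i. site_views ?e i @ [Inbox None]),
     coord_history = coord_history ?d @ [?up],
     message_count = message_count ?d + of_bool (fst obs t)\<rparr>"
    by (simp add: payoff_phase_def comm_phase_def rounds)
  then show ?thesis
    using d ok by (simp add: state_ok_def reports_Suc last_message_def)
qed

lemma run_state: "t \<le> T \<Longrightarrow> state_ok t (run A k \<omega> s p t)"
proof (induction t)
  case 0
  show ?case by (simp add: state_ok_def initial_config_def reports_def)
next
  case (Suc t)
  then show ?case using payoff_phase_state[of t "run A k \<omega> s p t"] by simp
qed

lemma chosen_expert_eq: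
  assumes t: "t < T"
  shows "chosen_expert A k \<omega> s p t = leader_at n p obs t"
proof -
  have "s t < k" using adv t by (simp add: oblivious_adversary_def)
  then have "last_message (site_views (query_phase A k \<omega> (s t) (run A k \<omega> s p t)) (s t))
      = [real (leader_at n p obs t)]"
    using query_phase_state(4)[OF t run_state] t by simp
  then show ?thesis
    using leader_at_less[OF n, of p obs t] by (simp add: chosen_expert_def lazy_leader_algorithm_def)
qed

lemma message_count_eq:
  "message_count (run A k \<omega> s p T) = (\<Sum>t<T. of_bool (fst obs t) +
     (if t = 0 \<or> leader_at n p obs t \<noteq> leader_at n p obs (t - 1) then k else 0))"
  using run_state[of T] by (simp add: state_ok_def down_count_def)

end

subsection \<open>The law of the random samples\<close>

text \<open>The samples live on sets of this kind, so measurability and equality of laws reduce to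
  singletons.\<close>

lemma countable_finite_support:
  fixes d :: "'b :: countable"
  assumes "finite A"
  shows "countable {f. \<forall>x. x \<notin> A \<longrightarrow> f x = d}"
proof (rule countable_subset)
  show "countable ((\<lambda>h x. if x \<in> A then h x else d) ` PiE A (\<lambda>_. UNIV))"
    using assms by (intro countable_image countable_PiE) auto
  show "{f. \<forall>x. x \<notin> A \<longrightarrow> f x = d} \<subseteq> (\<lambda>h x. if x \<in> A then h x else d) ` PiE A (\<lambda>_. UNIV)"
  proof
    fix f assume "f \<in> {f. \<forall>x. x \<notin> A \<longrightarrow> f x = d}"
    then show "f \<in> (\<lambda>h x. if x \<in> A then h x else d) ` PiE A (\<lambda>_. UNIV)"
      by (intro image_eqI[where x="restrict f A"]) (simp_all add: fun_eq_iff)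
  qed
qed

lemma finite_nodes [simp]: "finite (nodes k)"
  by (simp add: nodes_def)

lemma prod_nodes: "(\<Prod>v\<in>nodes k. f v) = f Coordinator * (\<Prod>i<k. f (Site i))"
  unfolding nodes_def by (subst prod.insert) (auto simp: prod.reindex inj_on_def)

lemma prob_space_tape_law: "prob_space (tape_law (lazy_leader_algorithm n k T q \<pi>) v)"
  by (cases v) (simp_all add: lazy_leader_algorithm_def measure_pmf.prob_space_axioms)

lemma sets_tape_law: "sets (tape_law (lazy_leader_algorithm n k T q \<pi>) v) = UNIV"
  and space_tape_law: "space (tape_law (lazy_leader_algorithm n k T q \<pi>) v) = UNIV"
  by (cases v; simp add: lazy_leader_algorithm_def)+

context
  fixes n k T :: nat and q \<pi> :: real and s :: "nat \<Rightarrow> nat"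
  assumes s: "\<And>t. t < T \<Longrightarrow> s t < k" and q: "0 \<le> q" "q \<le> 1"
begin

private abbreviation "alg \<equiv> lazy_leader_algorithm n k T q \<pi>"
private abbreviation "M \<equiv> randomness k alg"

interpretation P: product_prob_space "tape_law alg" "nodes k"
  by (intro product_prob_spaceI prob_space_tape_law)

text \<open>A site's tape is constrained only at the times of its own queries. Thus the coins are
  divided among the sites without overlap.\<close>

definition cylinder :: "(nat \<Rightarrow> bool) \<times> (nat \<Rightarrow> nat) \<Rightarrow> node \<Rightarrow> tape set" where
  "cylinder x v = (case v of
      Coordinator \<Rightarrow> {r. \<forall>a<n. nat \<lfloor>r a\<rfloor> = snd x a}
    | Site i \<Rightarrow> {r. \<forall>t<T. s t = i \<longrightarrow> r t > 0 \<longleftrightarrow> fst x t})"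

definition samples :: "((nat \<Rightarrow> bool) \<times> (nat \<Rightarrow> nat)) set" where
  "samples = {c. \<forall>t. t \<notin> {..<T} \<longrightarrow> c t = False} \<times> {z. \<forall>a. a \<notin> {..<n} \<longrightarrow> z a = 0}"

lemma countable_samples: "countable samples"
  unfolding samples_def by (intro countable_SIGMA countable_finite_support) auto

lemma observed_in_samples: "observed n T s \<omega> \<in> samples"
  by (simp add: observed_def samples_def)

text \<open>Every condition on the sample concerns the tape of a single node, so the event is a
  product set; \<open>s t < k\<close> puts the queried sites among the nodes.\<close>

lemma vimage_observed:
  assumes "x \<in> samples"
  shows "observed n T s -` {x} \<inter> space M = PiE (nodes k) (cylinder x)"
proof -
  have "observed n T s \<omega> = x \<longleftrightarrow> (\<forall>v\<in>nodes k. \<omega> v \<in> cylinder x v)" for \<omega>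
  proof -
    obtain c z where x: "x = (c, z)" by (cases x)
    have "observed n T s \<omega> = x \<longleftrightarrow>
        (\<forall>t<T. \<omega> (Site (s t)) t > 0 \<longleftrightarrow> c t) \<and> (\<forall>a<n. nat \<lfloor>\<omega> Coordinator a\<rfloor> = z a)"
      using assms unfolding x observed_def samples_def by (auto simp: fun_eq_iff)
    also have "(\<forall>t<T. \<omega> (Site (s t)) t > 0 \<longleftrightarrow> c t) \<longleftrightarrow>
        (\<forall>i<k. \<forall>t<T. s t = i \<longrightarrow> \<omega> (Site i) t > 0 \<longleftrightarrow> c t)"
      using s by blast
    finally show ?thesis
      unfolding nodes_def cylinder_def x by auto
  qed
  then show ?thesis
    by (auto simp: randomness_def space_PiM space_tape_law PiE_def Pi_def)
qed

lemma measurable_observed: "observed n T s \<in> M \<rightarrow>\<^sub>M count_space UNIV"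
proof -
  have "observed n T s -` {x} \<inter> space M \<in> sets M" if "x \<in> samples" for x
    unfolding vimage_observed[OF that] unfolding randomness_def
    by (intro sets_PiM_I_finite) (auto simp: sets_tape_law)
  then have "observed n T s \<in> M \<rightarrow>\<^sub>M count_space samples"
    using countable_samples observed_in_samples by (subst measurable_count_space_eq_countable) auto
  then show ?thesis
    by (rule measurable_compose[where f="observed n T s" and g="\<lambda>x. x"]) simp
qed

lemma prob_cylinder_site:
  "measure (tape_law alg (Site i)) (cylinder (c, z) (Site i))
    = (\<Prod>t<T. if s t = i then pmf (bernoulli_pmf q) (c t) else 1)"
proof -
  have "(\<lambda>c t. of_bool (c t)) -` cylinder (c, z) (Site i)
      = Pi {..<T} (\<lambda>t. if s t = i then {c t} else UNIV)"
    by (auto simp: cylinder_def Pi_def)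
  then have "measure (tape_law alg (Site i)) (cylinder (c, z) (Site i))
      = measure (coins_pmf T q) (Pi {..<T} (\<lambda>t. if s t = i then {c t} else UNIV))"
    by (simp add: lazy_leader_algorithm_def)
  also have "\<dots> = (\<Prod>t<T. measure (bernoulli_pmf q) (if s t = i then {c t} else UNIV))"
    unfolding coins_pmf_def by (simp add: measure_Pi_pmf_Pi)
  also have "\<dots> = (\<Prod>t<T. if s t = i then pmf (bernoulli_pmf q) (c t) else 1)"
    by (intro prod.cong) (auto simp: measure_pmf_single)
  finally show ?thesis .
qed

lemma prob_cylinder_coordinator:
  assumes "(c, z) \<in> samples"
  shows "measure (tape_law alg Coordinator) (cylinder (c, z) Coordinator) = pmf (noise_pmf n \<pi>) z"
proof -
  have "measure (tape_law alg Coordinator) (cylinder (c, z) Coordinator)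
      = measure (noise_pmf n \<pi>) (Pi {..<n} (\<lambda>a. {z a}))"
    by (simp add: lazy_leader_algorithm_def cylinder_def Pi_def vimage_def)
  also have "\<dots> = (\<Prod>a<n. pmf (geometric_pmf \<pi>) (z a))"
    unfolding noise_pmf_def by (simp add: measure_Pi_pmf_Pi measure_pmf_single)
  also have "\<dots> = pmf (noise_pmf n \<pi>) z"
    unfolding noise_pmf_def using assms by (subst pmf_Pi') (auto simp: samples_def)
  finally show ?thesis .
qed

text \<open>Both laws live on a countable set, so singletons suffice. There the independence of the
  tapes gives a product over nodes, to be matched with a product over time steps.\<close>

lemma distr_observed:
  "distr M (count_space UNIV) (observed n T s) = measure_pmf (sample_pmf n T q \<pi>)"
proof (rule measure_eqI_countable_AE[where \<Omega>=samples])
  show "AE x in distr M (count_space UNIV) (observed n T s). x \<in> samples"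
    using measurable_observed observed_in_samples by (subst AE_distr_iff) auto
  have "fst x \<in> set_pmf (coins_pmf T q)" "snd x \<in> set_pmf (noise_pmf n \<pi>)"
    if "x \<in> set_pmf (sample_pmf n T q \<pi>)" for x
    using that by (auto simp: sample_pmf_def)
  then show "AE x in measure_pmf (sample_pmf n T q \<pi>). x \<in> samples"
    using set_Pi_pmf_subset[of "{..<T}" False "\<lambda>_. bernoulli_pmf q"]
      set_Pi_pmf_subset[of "{..<n}" 0 "\<lambda>_. geometric_pmf \<pi>"]
    unfolding AE_measure_pmf_iff samples_def coins_pmf_def noise_pmf_def by fastforce
  show "emeasure (distr M (count_space UNIV) (observed n T s)) {x}
      = emeasure (measure_pmf (sample_pmf n T q \<pi>)) {x}" if x: "x \<in> samples" for x
  proof -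
    obtain c z where cz: "x = (c, z)" by (cases x)
    have "emeasure (distr M (count_space UNIV) (observed n T s)) {x}
        = emeasure M (PiE (nodes k) (cylinder x))"
      using measurable_observed vimage_observed[OF x] by (simp add: emeasure_distr)
    also have "\<dots> = (\<Prod>v\<in>nodes k. emeasure (tape_law alg v) (cylinder x v))"
      unfolding randomness_def by (rule P.emeasure_PiM) (auto simp: sets_tape_law)
    also have "\<dots> = ennreal (\<Prod>v\<in>nodes k. measure (tape_law alg v) (cylinder x v))"
      using P.M.emeasure_eq_measure by (simp add: prod_ennreal)
    also have "(\<Prod>v\<in>nodes k. measure (tape_law alg v) (cylinder x v)) = pmf (noise_pmf n \<pi>) z
        * (\<Prod>i<k. \<Prod>t<T. if s t = i then pmf (bernoulli_pmf q) (c t) else 1)"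
      using x unfolding cz by (simp add: prod_nodes prob_cylinder_site prob_cylinder_coordinator)
    \<comment> \<open>At time \<open>t\<close> only the site \<open>s t\<close> contributes a
      nontrivial factor, so the swap leaves one coin per time step.\<close>
    also have "(\<Prod>i<k. \<Prod>t<T. if s t = i then pmf (bernoulli_pmf q) (c t) else 1)
        = (\<Prod>t<T. \<Prod>i<k. if s t = i then pmf (bernoulli_pmf q) (c t) else 1)"
      by (rule prod.swap)
    also have "\<dots> = (\<Prod>t<T. pmf (bernoulli_pmf q) (c t))"
      using s by (intro prod.cong) (auto simp: prod.delta')
    also have "\<dots> = pmf (coins_pmf T q) c"
      unfolding coins_pmf_def using x cz by (subst pmf_Pi') (auto simp: samples_def)
    also have "pmf (noise_pmf n \<pi>) z * pmf (coins_pmf T q) c = pmf (sample_pmf n T q \<pi>) x"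
      by (simp add: sample_pmf_def cz pmf_pair)
    finally show ?thesis by (simp add: emeasure_pmf_single)
  qed
  show "sets (distr M (count_space UNIV) (observed n T s)) = UNIV" by simp
  show "sets (measure_pmf (sample_pmf n T q \<pi>)) = UNIV" by simp
qed (rule countable_samples)

lemma integral_observed:
  fixes f :: "_ \<Rightarrow> real"
  shows "(\<integral>\<omega>. f (observed n T s \<omega>) \<partial>M) = measure_pmf.expectation (sample_pmf n T q \<pi>) f"
proof -
  have "(\<integral>\<omega>. f (observed n T s \<omega>) \<partial>M) = integral\<^sup>L (distr M (count_space UNIV) (observed n T s)) f"
    by (rule integral_distr[symmetric]) (rule measurable_observed, simp)
  then show ?thesis by (simp only: distr_observed)
qed

end

subsection \<open>Guarantees of the algorithm\<close>

text \<open>The chosen expert and the message count are functions of \<open>observed\<close>, a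
  measurable map into a discrete space. The bounds on \<open>pick\<close> and on message lengths
  range over all views, even those that never arise, hence the \<open>min\<close> and the
  \<open>take n\<close> in the algorithm.\<close>

lemma valid_lazy_leader_algorithm:
  assumes n: "n \<ge> 1" and q: "0 \<le> q" "q \<le> 1"
  shows "valid_algorithm n k T (lazy_leader_algorithm n k T q \<pi>)"
    (is "valid_algorithm n k T ?A")
  unfolding valid_algorithm_def
proof (intro conjI allI impI ballI)
  show "prob_space (tape_law ?A v)" for v
    by (rule prob_space_tape_law)
  show "pick ?A i r view < n" for i r view
    using n by (simp add: lazy_leader_algorithm_def)
  show "length m \<le> n" if "site_send ?A i r view = Some m" for i r view m
    using that by (auto simp: lazy_leader_algorithm_def split: site_event.splits option.splits if_splits)
  show "length m \<le> n" if "coord_send ?A r view i = Some m" for i r view m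
    using that n by (auto simp: lazy_leader_algorithm_def split: if_splits)
next
  fix s p t assume adv: "oblivious_adversary n k T s p" and t: "t < T"
  have "observed n T s \<in> randomness k ?A \<rightarrow>\<^sub>M count_space UNIV"
    by (rule measurable_observed) (use adv q in \<open>auto simp: oblivious_adversary_def\<close>)
  then show "(\<lambda>\<omega>. chosen_expert ?A k \<omega> s p t) \<in> randomness k ?A \<rightarrow>\<^sub>M count_space UNIV"
    unfolding chosen_expert_eq[OF n adv t]
    by (rule measurable_compose[where g="\<lambda>x. leader_at n p x t"]) simp
next
  fix s p assume adv: "oblivious_adversary n k T s p"
  have "observed n T s \<in> randomness k ?A \<rightarrow>\<^sub>M count_space UNIV"
    by (rule measurable_observed) (use adv q in \<open>auto simp: oblivious_adversary_def\<close>)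
  then show "(\<lambda>\<omega>. message_count (run ?A k \<omega> s p T)) \<in> randomness k ?A \<rightarrow>\<^sub>M count_space UNIV"
    unfolding message_count_eq[OF n adv]
    by (rule measurable_compose[where g="\<lambda>x. \<Sum>t<T. of_bool (fst x t) +
     (if t = 0 \<or> leader_at n p x t \<noteq> leader_at n p x (t - 1) then k else 0)"]) simp
qed

text \<open>A single expert leaves no choice and no regret. This case is kept apart because the
  target bound vanishes there with its factor \<open>ln n\<close>.\<close>

lemma expected_regret_lazy_leader:
  assumes n: "n \<ge> 1" and q: "0 < q" "q \<le> 1" and \<pi>: "0 < \<pi>" "\<pi> \<le> 1"
    and adv: "oblivious_adversary n k T s p"
  shows "expected_regret n k T (lazy_leader_algorithm n k T q \<pi>) s p
    \<le> (if n = 1 then 0 else \<pi> * real T + (ln (real n) + 2) / (\<pi> * q))"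
proof -
  let ?E = "measure_pmf.expectation (sample_pmf n T q \<pi>)"
  have s: "s t < k" and p: "a < n \<Longrightarrow> 0 \<le> p t ! a \<and> p t ! a \<le> 1" if "t < T" for t a
    using adv that by (auto simp: oblivious_adversary_def)
  note less = leader_at_less[OF n]
  \<comment> \<open>The best expert in hindsight is not random, as the adversary is oblivious; it
    can be fixed before taking expectations.\<close>
  have "Max ((\<lambda>a. \<Sum>t<T. p t ! a) ` {..<n}) \<in> (\<lambda>a. \<Sum>t<T. p t ! a) ` {..<n}"
    using n by (intro Max_in) (auto simp: lessThan_empty_iff)
  then obtain a where a: "a < n" "Max ((\<lambda>a. \<Sum>t<T. p t ! a) ` {..<n}) = (\<Sum>t<T. p t ! a)"
    by auto
  have "0 \<le> p t ! leader_at n p x t \<and> p t ! leader_at n p x t \<le> 1" if "t < T" for t x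
    using p[OF that less] .
  then have "(\<Sum>t<T. p t ! leader_at n p x t) \<le> (\<Sum>t<T. 1)" "0 \<le> (\<Sum>t<T. p t ! leader_at n p x t)" for x
    by (intro sum_mono sum_nonneg; simp)+
  then have "\<bar>\<Sum>t<T. p t ! leader_at n p x t\<bar> \<le> real T" for x
    by simp
  then have int: "integrable (sample_pmf n T q \<pi>) (\<lambda>x. \<Sum>t<T. p t ! leader_at n p x t)"
    by (rule integrable_bounded_pmf)
  have "expected_regret n k T (lazy_leader_algorithm n k T q \<pi>) s p
      = (\<integral>\<omega>. (\<Sum>t<T. p t ! a) - (\<Sum>t<T. p t ! leader_at n p (observed n T s \<omega>) t)
          \<partial>randomness k (lazy_leader_algorithm n k T q \<pi>))"
    unfolding expected_regret_def regret_def a(2)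
    using chosen_expert_eq[OF n adv] by simp
  also have "\<dots> = ?E (\<lambda>x. (\<Sum>t<T. p t ! a) - (\<Sum>t<T. p t ! leader_at n p x t))"
    using q s by (intro integral_observed) auto
  also have "\<dots> = (\<Sum>t<T. p t ! a) - ?E (\<lambda>x. \<Sum>t<T. p t ! leader_at n p x t)"
    using int by simp
  finally have eq: "expected_regret n k T (lazy_leader_algorithm n k T q \<pi>) s p
      = (\<Sum>t<T. p t ! a) - ?E (\<lambda>x. \<Sum>t<T. p t ! leader_at n p x t)" .
  show ?thesis
  proof (cases "n = 1")
    case True
    then have "a = 0" "leader_at n p x t = 0" for x t using less[of p x t] a by auto
    then show ?thesis using True eq by simp
  next
    case False
    then show ?thesis
      unfolding eq using expected_regret_bound[OF n q \<pi> p a(1)] by simp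
  qed
qed

lemma expected_communication_lazy_leader:
  assumes n: "n \<ge> 1" and q: "0 < q" "q \<le> 1" and \<pi>: "0 < \<pi>" "\<pi> \<le> 1"
    and adv: "oblivious_adversary n k T s p"
  shows "expected_communication k T (lazy_leader_algorithm n k T q \<pi>) s p
    \<le> q * real T + real k + real k * (q * \<pi> * real T)"
proof -
  let ?D = "sample_pmf n T q \<pi>"
  let ?E = "measure_pmf.expectation ?D"
  let ?ch = "\<lambda>t x. of_bool (leader_at n p x t \<noteq> leader_at n p x (Suc t)) :: real"
  let ?f = "\<lambda>x. \<Sum>t<T. of_bool (fst x t) +
     (if t = 0 \<or> leader_at n p x t \<noteq> leader_at n p x (t - 1) then k else 0)"
  have s: "s t < k" and p: "a < n \<Longrightarrow> 0 \<le> p t ! a \<and> p t ! a \<le> 1" if "t < T" for t a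
    using adv that by (auto simp: oblivious_adversary_def)
  have int: "integrable ?D (\<lambda>x. of_bool (fst x t) :: real)" "integrable ?D (?ch t)" for t
    by (rule integrable_bounded_pmf[where B=1], simp)+
  have f: "real (?f x) = (\<Sum>t<T. of_bool (fst x t))
      + (\<Sum>t<T. if t = 0 \<or> leader_at n p x t \<noteq> leader_at n p x (t - 1) then real k else 0)" for x
    by (simp add: sum.distrib if_distrib[of real] cong: if_cong)
  \<comment> \<open>Broadcasts compare \<open>t\<close> with \<open>t - 1\<close>, whereas
    \<open>?ch\<close> compares \<open>t\<close> with \<open>Suc t\<close>. The index shift sets the
    first broadcast apart, and a change after the last step only enlarges the bound.\<close>
  have changes: "(\<Sum>t<T. if t = 0 \<or> leader_at n p x t \<noteq> leader_at n p x (t - 1) then real k else 0)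
      \<le> real k + real k * (\<Sum>t<T. ?ch t x)" for x
  proof (cases T)
    case (Suc m)
    have "(\<Sum>t<T. if t = 0 \<or> leader_at n p x t \<noteq> leader_at n p x (t - 1) then real k else 0)
        = real k + (\<Sum>t<m. real k * ?ch t x)"
      unfolding Suc sum.lessThan_Suc_shift by (intro arg_cong2[where f="(+)"] sum.cong) auto
    also have "\<dots> \<le> real k + (\<Sum>t<T. real k * ?ch t x)" by (simp add: Suc)
    finally show ?thesis unfolding sum_distrib_left .
  qed simp
  have le: "real (?f x)
      \<le> (\<Sum>t<T. of_bool (fst x t)) + (real k + real k * (\<Sum>t<T. ?ch t x))" for x
    unfolding f by (rule add_left_mono[OF changes])
  have "?f x \<le> (\<Sum>t<T. 1 + k)" for x by (rule sum_mono) auto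
  then have "\<bar>real (?f x)\<bar> \<le> real (\<Sum>t<T. 1 + k)" for x by (simp only: of_nat_le_iff abs_of_nat)
  then have intf: "integrable ?D (\<lambda>x. real (?f x))" by (rule integrable_bounded_pmf)
  have "expected_communication k T (lazy_leader_algorithm n k T q \<pi>) s p = ?E (\<lambda>x. real (?f x))"
    unfolding expected_communication_def message_count_eq[OF n adv]
    using q s by (intro integral_observed) auto
  also have "\<dots> \<le> ?E (\<lambda>x. (\<Sum>t<T. of_bool (fst x t)) + (real k + real k * (\<Sum>t<T. ?ch t x)))"
    by (intro integral_mono intf le Bochner_Integration.integrable_add
        Bochner_Integration.integrable_sum integrable_mult_right int) simp
  also have "\<dots> = (\<Sum>t<T. ?E (\<lambda>x. of_bool (fst x t))) + (real k + real k * (\<Sum>t<T. ?E (?ch t)))"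
    using int by (subst Bochner_Integration.integral_add)
      (auto simp: Bochner_Integration.integral_sum Bochner_Integration.integral_add
        simp del: sum_of_bool_eq)
  also have "\<dots> \<le> (\<Sum>t<T. q) + (real k + real k * (\<Sum>t<T. q * \<pi>))"
    using expectation_coin[OF n q \<pi> p] expectation_changes[OF n q \<pi> p]
    by (intro add_mono mult_left_mono sum_mono) auto
  finally show ?thesis by (simp add: mult_ac)
qed

section \<open>Choice of the parameters and of the constant\<close>

theorem theorem1:
  "\<exists>C::real. C > 0 \<and>
    (\<forall>(\<epsilon>::real) (n::nat) (k::nat) (T::nat).
      0 < \<epsilon> \<and> \<epsilon> < 1/5 \<and> n \<ge> 1 \<and> k \<ge> 1 \<and> real T \<ge> 2 * real k powr (23/10) \<longrightarrow>
      (\<exists>A. valid_algorithm n k T A \<and>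
        (\<forall>s p. oblivious_adversary n k T s p \<longrightarrow>
          expected_regret n k T A s p
            \<le> C * (ln (real n) * sqrt (real k powr (5 * (1 + \<epsilon>) / 6) * real T)) \<and>
          expected_communication k T A s p \<le> C * (real T / real k powr \<epsilon>))))"
proof (intro exI[of _ 7] conjI allI impI)
  fix \<epsilon> :: real and n k T :: nat
  assume "0 < \<epsilon> \<and> \<epsilon> < 1/5 \<and> n \<ge> 1 \<and> k \<ge> 1 \<and> real T \<ge> 2 * real k powr (23/10)"
  then have \<epsilon>: "0 < \<epsilon>" "\<epsilon> < 1/5" and n: "n \<ge> 1" and k: "real k \<ge> 1"
    and T: "real T \<ge> 2 * real k powr (23/10)" by auto
  define R where "R = sqrt (real k powr (5 * (1 + \<epsilon>) / 6) * real T)"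
  define q where "q = real k powr (- \<epsilon>)"
  define \<pi> where "\<pi> = real k powr \<epsilon> / R"
  \<comment> \<open>The lower bound on the horizon enters through the exponents 0,
    \<open>1 + \<epsilon>\<close> and \<open>7 * (1 + \<epsilon>) / 6\<close>, all below
    23/10.\<close>
  have k_powr: "real k powr a \<le> real T" if "a \<le> 23/10" for a
    using powr_mono[OF that k] T by (smt (verit) powr_ge_zero)
  have T1: "real T \<ge> 1" using k_powr[of 0] k by simp
  have R: "R > 0" and R2: "R\<^sup>2 = real k powr (5 * (1 + \<epsilon>) / 6) * real T"
    unfolding R_def using T1 k by auto
  have q: "0 < q" "q \<le> 1"
    using k \<epsilon> powr_mono[of "-\<epsilon>" 0 "real k"] by (auto simp: q_def)
  \<comment> \<open>The aim is \<open>k * \<pi> \<le> 1\<close>, that is, broadcasting the changes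
    costs no more than the reports. After splitting off the exponent in \<open>R\<^sup>2\<close>,
    the rest \<open>7 * (1 + \<epsilon>) / 6\<close> is paid by \<open>T\<close>.\<close>
  have "(real k powr (1 + \<epsilon>))\<^sup>2 = real k powr (2 * (1 + \<epsilon>))"
    using k by (simp add: powr_powr[symmetric] powr_realpow[symmetric] powr_powr mult.commute)
  also have "\<dots> = real k powr (5 * (1 + \<epsilon>) / 6) * real k powr (7 * (1 + \<epsilon>) / 6)"
    unfolding powr_add[symmetric]
    by (rule arg_cong[where f="\<lambda>e. real k powr e"]) (simp add: field_simps)
  also have "\<dots> \<le> R\<^sup>2"
    unfolding R2 using \<epsilon> by (intro mult_left_mono k_powr) auto
  finally have "real k powr (1 + \<epsilon>) \<le> R"
    using R by (auto intro: power2_le_imp_le)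
  then have k\<pi>: "real k * \<pi> \<le> 1"
    using R k by (simp add: \<pi>_def powr_add)
  have \<pi>: "0 < \<pi>" using R k by (simp add: \<pi>_def)
  have "\<pi> \<le> real k * \<pi>" using \<pi> k by simp
  with k\<pi> have \<pi>1: "\<pi> \<le> 1" by simp
  \<comment> \<open>The powers of \<open>k\<close> cancel, so the noise term
    \<open>(ln n + 2) / (\<pi> * q)\<close> becomes a multiple of \<open>R\<close>.\<close>
  have \<pi>q: "\<pi> * q = 1 / R"
    using k by (simp add: \<pi>_def q_def powr_minus field_simps)
  \<comment> \<open>After multiplication by \<open>R\<close> this compares the exponents
    \<open>\<epsilon>\<close> and \<open>5 * (1 + \<epsilon>) / 6\<close>.\<close>
  have \<pi>T: "\<pi> * real T \<le> R"
  proof -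
    have "real k powr \<epsilon> * real T \<le> R\<^sup>2"
      unfolding R2 using \<epsilon> k by (intro mult_right_mono powr_mono) auto
    then show ?thesis using R by (simp add: \<pi>_def field_simps power2_eq_square)
  qed
  have kT: "real k \<le> real T * q"
  proof -
    have "real k * real k powr \<epsilon> \<le> real T"
      using k_powr[of "1 + \<epsilon>"] \<epsilon> k by (simp add: powr_add)
    then show ?thesis using k by (simp add: q_def powr_minus field_simps)
  qed
  let ?A = "lazy_leader_algorithm n k T q \<pi>"
  show "\<exists>A. valid_algorithm n k T A \<and>
        (\<forall>s p. oblivious_adversary n k T s p \<longrightarrow>
          expected_regret n k T A s p
            \<le> 7 * (ln (real n) * sqrt (real k powr (5 * (1 + \<epsilon>) / 6) * real T)) \<and>
          expected_communication k T A s p \<le> 7 * (real T / real k powr \<epsilon>))"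
  proof (intro exI[of _ ?A] conjI allI impI)
    show "valid_algorithm n k T ?A"
      using n q by (intro valid_lazy_leader_algorithm) auto
  next
    fix s p assume adv: "oblivious_adversary n k T s p"
    show "expected_regret n k T ?A s p
        \<le> 7 * (ln (real n) * sqrt (real k powr (5 * (1 + \<epsilon>) / 6) * real T))"
    proof (cases "n = 1")
      case True
      then show ?thesis using expected_regret_lazy_leader[OF n q \<pi> \<pi>1 adv] by simp
    next
      case False
      \<comment> \<open>For \<open>n \<ge> 2\<close> the additive 3 is absorbed using
        \<open>ln 2 \<ge> 2/3\<close>; this is where the constant 7 comes from.\<close>
      have "ln 2 \<le> ln (real n)" using False n by simp
      then have "3 \<le> 6 * ln (real n)" using ln2_ge_two_thirds by simp
      then have "ln (real n) + 3 \<le> 7 * ln (real n)" by simp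
      have "expected_regret n k T ?A s p \<le> \<pi> * real T + (ln (real n) + 2) / (\<pi> * q)"
        using expected_regret_lazy_leader[OF n q \<pi> \<pi>1 adv] False by simp
      also have "\<dots> \<le> R + (ln (real n) + 2) * R"
        using \<pi>T by (simp add: \<pi>q)
      also have "\<dots> = (ln (real n) + 3) * R" by (simp add: algebra_simps)
      also have "\<dots> \<le> 7 * ln (real n) * R"
        using \<open>ln (real n) + 3 \<le> 7 * ln (real n)\<close> R by (intro mult_right_mono) auto
      finally show ?thesis by (simp add: R_def mult.assoc)
    qed
  next
    fix s p assume adv: "oblivious_adversary n k T s p"
    \<comment> \<open>The reports, the first broadcast and the later broadcasts each contribute at
      most \<open>q * T\<close>, which gives the factor 3.\<close>
    have "real k * (q * \<pi> * real T) = (real k * \<pi>) * (q * real T)" by simp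
    also have "\<dots> \<le> 1 * (q * real T)" using k\<pi> q by (intro mult_right_mono) auto
    finally have "expected_communication k T ?A s p \<le> 3 * (real T * q)"
      using expected_communication_lazy_leader[OF n q \<pi> \<pi>1 adv] kT by (simp add: mult.commute)
    also have "\<dots> \<le> 7 * (real T * q)" using q by simp
    finally show "expected_communication k T ?A s p \<le> 7 * (real T / real k powr \<epsilon>)"
      by (simp add: q_def powr_minus divide_inverse)
  qed
qed simp

end
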